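(* Let $d,n\geq1$ be integers and let $p=\frac{n(n-1)}{2}\cdot(d-1)+1$. Let $\boldsymbol{\phi}=(\phi_1,\dots,\phi_p):(\mathbb{R}^d)^n\to\mathbb{R}^p$, where $\phi_1,\dots,\phi_p$ are anti-symmetric polynomials such that for any $\mathbf{x}=(\mathbf{x}_1,\dots,\mathbf{x}_n)\in(\mathbb{R}^d)^n$, $\phi_1(\mathbf{x})=\cdots=\phi_p(\mathbf{x})=0$ if and only if $\mathbf{x}_i=\mathbf{x}_j$ for some $i,j\in\{1,\dots,n\}$ with $i\neq j$. Let $\boldsymbol{\psi}=(\psi_1,\dots,\psi_q):(\mathbb{R}^d)^n\to\mathbb{R}^q$, where $\psi_1,\dots,\psi_q$ are symmetric polynomials generating the $\mathbb{R}$-algebra of all symmetric polynomials on $(\mathbb{R}^d)^n$. Consider the polynomial map $$\boldsymbol{\eta}=(\boldsymbol{\phi},\psi_1\boldsymbol{\phi},\psi_2\boldsymbol{\phi},\dots,\psi_q\boldsymbol{\phi}):(\mathbb{R}^d)^n\to\mathbb{R}^m=\mathbb{R}^{p(q+1)}.$$ Then the Jacobian matrix $J\boldsymbol{\eta}(\mathbf{x})\in\mathbb{R}^{m\times nd}$ is of full column rank for any $\mathbf{x}\in(\mathbb{R}^d)^n$ with $\mathbf{x}\notin\mathbf{Sing}_{d,n}$.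
   Context: $\mathbf{Sing}_{d,n}:=\{\mathbf{x}=(\mathbf{x}_1,\dots,\mathbf{x}_n)\in(\mathbb{R}^d)^n : \exists\, i_1\neq i_2,\ \mathbf{x}_{i_1}=\mathbf{x}_{i_2}\}$. $S_n$ is the group of permutations of $\{1,\dots,n\}$ and $(-1)^\sigma$ the signature of $\sigma$. A function $f:(\mathbb{R}^d)^n\to\mathbb{R}$ is symmetric if $f(\mathbf{x}_{\sigma(1)},\dots,\mathbf{x}_{\sigma(n)})=f(\mathbf{x}_1,\dots,\mathbf{x}_n)$ for all $\sigma\in S_n$ and all $\mathbf{x}_1,\dots,\mathbf{x}_n\in\mathbb{R}^d$, and anti-symmetric if $f(\mathbf{x}_{\sigma(1)},\dots,\mathbf{x}_{\sigma(n)})=(-1)^\sigma f(\mathbf{x}_1,\dots,\mathbf{x}_n)$ for all such $\sigma$ and $\mathbf{x}_1,\dots,\mathbf{x}_n$. Polynomials on $(\mathbb{R}^d)^n$ are real polynomials in the $nd$ coordinates $x_{i,j}$ ($x_{i,j}$ being the $j$-th entry of $\mathbf{x}_i$). *)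

theory Defs
  imports "HOL-Analysis.Analysis"
begin

text \<open>
  A point \<open>x = (x\<^sub>1, \<dots>, x\<^sub>n)\<close> of \<open>(\<real>\<^sup>d)\<^sup>n\<close> is an \<open>x :: real ^ 'd ^ 'n\<close> with
  \<open>CARD('d) = d\<close> and \<open>CARD('n) = n\<close>; \<open>x $ i\<close> is the \<open>i\<close>-th vector and \<open>x $ i $ j\<close> its \<open>j\<close>-th entry.
  Polynomials on this space are the library's \<^const>\<open>real_polynomial_function\<close>s: the functions built
  from real constants and linear functionals, i.e. linear combinations of the coordinates,
  by sums and products. Over the infinite field of reals these correspond one-to-one to formal
  polynomials in the \<open>x $ i $ j\<close>.
\<close>

definition Sing :: "(real ^ 'd ^ 'n) set" where
  "Sing = {x. \<exists>i j. i \<noteq> j \<and> x $ i = x $ j}"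

definition symmetric :: "(real ^ 'd ^ 'n \<Rightarrow> real) \<Rightarrow> bool" where
  "symmetric f \<longleftrightarrow> (\<forall>\<sigma> x. \<sigma> permutes UNIV \<longrightarrow> f (\<chi> i. x $ \<sigma> i) = f x)"

definition antisymmetric :: "(real ^ 'd ^ 'n \<Rightarrow> real) \<Rightarrow> bool" where
  "antisymmetric f \<longleftrightarrow>
    (\<forall>\<sigma> x. \<sigma> permutes UNIV \<longrightarrow> f (\<chi> i. x $ \<sigma> i) = of_int (sign \<sigma>) * f x)"

text \<open>The unital \<open>\<real>\<close>-subalgebra, under pointwise operations, generated by a set of functions.\<close>

inductive_set generated_algebra :: "('a \<Rightarrow> real) set \<Rightarrow> ('a \<Rightarrow> real) set"
  for S :: "('a \<Rightarrow> real) set"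
  where
    gen: "f \<in> S \<Longrightarrow> f \<in> generated_algebra S"
  | const: "(\<lambda>x. c) \<in> generated_algebra S"
  | add: "f \<in> generated_algebra S \<Longrightarrow> g \<in> generated_algebra S \<Longrightarrow>
      (\<lambda>x. f x + g x) \<in> generated_algebra S"
  | mult: "f \<in> generated_algebra S \<Longrightarrow> g \<in> generated_algebra S \<Longrightarrow>
      (\<lambda>x. f x * g x) \<in> generated_algebra S"

text \<open>
  The components of \<open>\<eta> = (\<phi>, \<psi>\<^sub>1 \<phi>, \<dots>, \<psi>\<^sub>q \<phi>)\<close> are indexed by pairs: \<open>(None, k)\<close> stands for
  \<open>\<phi>\<^sub>k\<close> and \<open>(Some l, k)\<close> for \<open>\<psi>\<^sub>l \<phi>\<^sub>k\<close>.
\<close>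

definition eta :: "(real ^ 'd ^ 'n \<Rightarrow> real ^ 'p) \<Rightarrow> (real ^ 'd ^ 'n \<Rightarrow> real ^ 'q) \<Rightarrow>
    real ^ 'd ^ 'n \<Rightarrow> real ^ ('q option \<times> 'p)" where
  "eta \<phi> \<psi> x = (\<chi> a. case a of
      (None, k) \<Rightarrow> \<phi> x $ k
    | (Some l, k) \<Rightarrow> \<psi> x $ l * \<phi> x $ k)"

lemma card_eta_index: "CARD('q::finite option \<times> 'p::finite) = CARD('p) * (CARD('q) + 1)"
  by simp

text \<open>The derivative in the coordinate \<open>x $ i $ j\<close>; \<open>axis i (axis j 1)\<close> is the unit vector in that direction.\<close>

definition partial_deriv :: "'n \<Rightarrow> 'd \<Rightarrow> (real ^ 'd ^ 'n \<Rightarrow> real) \<Rightarrow> real ^ 'd ^ 'n \<Rightarrow> real" where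
  "partial_deriv i j f x = deriv (\<lambda>t. f (x + t *\<^sub>R axis i (axis j 1))) 0"

text \<open>
  The library's \<^const>\<open>jacobian\<close> only takes functions on \<open>real ^ 'a\<close>; here the columns are indexed
  by the coordinates \<open>(i, j)\<close> of \<open>real ^ 'd ^ 'n\<close>.
\<close>

definition jacobian_matrix ::
    "(real ^ 'd ^ 'n \<Rightarrow> real ^ 'm) \<Rightarrow> real ^ 'd ^ 'n \<Rightarrow> real ^ ('n \<times> 'd) ^ 'm" where
  "jacobian_matrix F x = (\<chi> a b. partial_deriv (fst b) (snd b) (\<lambda>y. F y $ a) x)"

end

theory Submission
  imports Defs
begin

text \<open>
  Fix \<open>x \<notin> Sing\<close>. The rank is full if every \<open>v\<close> along which all components of \<open>\<eta>\<close> have zero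
  derivative at \<open>x\<close> is zero; let \<open>v\<close> be such a vector. The components of \<open>x\<close> are distinct, so
  \<open>\<phi>\<^sub>k x \<noteq> 0\<close> for some \<open>k\<close>. Both \<open>\<phi>\<^sub>k\<close> and \<open>\<psi>\<^sub>l \<phi>\<^sub>k\<close> have zero derivative along \<open>v\<close>, and by the
  product rule so does each \<open>\<psi>\<^sub>l\<close>. The functions with zero derivative along \<open>v\<close> at \<open>x\<close> form an
  algebra (\<open>generated_algebra_derivative_zero\<close>), which therefore contains all symmetric polynomials,
  in particular \<open>y \<mapsto> \<Sum>\<^sub>i g (y\<^sub>i)\<close> for every polynomial \<open>g\<close> on \<open>\<real>\<^sup>d\<close>.

  For an index \<open>i\<close> take \<open>g z = ((z - x\<^sub>i) \<bullet> v\<^sub>i) * (\<Prod>j \<noteq> i. |z - x\<^sub>j|\<^sup>2)\<close>. Its derivative is zero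
  at every \<open>x\<^sub>j\<close> with \<open>j \<noteq> i\<close>, and its derivative at \<open>x\<^sub>i\<close> along \<open>v\<^sub>i\<close> is
  \<open>|v\<^sub>i|\<^sup>2 * (\<Prod>j \<noteq> i. |x\<^sub>i - x\<^sub>j|\<^sup>2)\<close> (\<open>separating_polynomial\<close>). This number is the derivative of
  \<open>y \<mapsto> \<Sum>\<^sub>j g (y\<^sub>j)\<close> at \<open>x\<close> along \<open>v\<close>, hence zero, and the product is not zero because the \<open>x\<^sub>j\<close> are
  distinct. So \<open>v\<^sub>i = 0\<close>.
\<close>

section \<open>Directional derivatives from the Jacobian matrix\<close>

lemma jacobian_matrix_mult_vector:
  fixes F :: "real ^ 'd ^ 'n \<Rightarrow> real ^ 'm"
  assumes "((\<lambda>y. F y $ a) has_derivative D) (at x)"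
  shows "(jacobian_matrix F x *v w) $ a = D (\<chi> i j. w $ (i, j))"
proof -
  have lin: "linear D"
    using assms by (rule has_derivative_linear)
  have partial: "partial_deriv i j (\<lambda>y. F y $ a) x = D (axis i (axis j 1))" for i j
  proof -
    have line: "((\<lambda>t. x + t *\<^sub>R axis i (axis j 1)) has_derivative (\<lambda>t. t *\<^sub>R axis i (axis j 1))) (at 0)"
      by (auto intro!: derivative_eq_intros)
    have "((\<lambda>t. F (x + t *\<^sub>R axis i (axis j 1)) $ a) has_derivative
        (\<lambda>t. D (t *\<^sub>R axis i (axis j 1)))) (at 0)"
      using has_derivative_compose[OF line] assms by simp
    then have "((\<lambda>t. F (x + t *\<^sub>R axis i (axis j 1)) $ a) has_field_derivative
        D (axis i (axis j 1))) (at 0)"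
      by (simp add: has_field_derivative_def linear_scale[OF lin] mult_commute_abs)
    then show ?thesis
      unfolding partial_deriv_def by (rule DERIV_imp_deriv)
  qed
  have "(\<chi> i j. w $ (i, j)) = (\<Sum>(i, j)\<in>UNIV. w $ (i, j) *\<^sub>R (axis i (axis j 1) :: real ^ 'd ^ 'n))"
  proof -
    have "(\<Sum>(i, j)\<in>UNIV. w $ (i, j) *\<^sub>R (axis i (axis j 1) :: real ^ 'd ^ 'n)) $ k $ l
        = w $ (k, l)" for k l
    proof -
      have "(\<Sum>(i, j)\<in>UNIV. w $ (i, j) *\<^sub>R (axis i (axis j 1) :: real ^ 'd ^ 'n)) $ k $ l
          = (\<Sum>b\<in>UNIV. if b = (k, l) then w $ b else 0)"
        unfolding sum_component by (rule sum.cong) (auto simp: axis_def split: if_splits)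
      then show ?thesis by simp
    qed
    then show ?thesis by (simp add: vec_eq_iff)
  qed
  then have "D (\<chi> i j. w $ (i, j)) = (\<Sum>(i, j)\<in>UNIV. w $ (i, j) * D (axis i (axis j 1)))"
    by (simp add: linear_sum[OF lin] linear_scale[OF lin] case_prod_unfold)
  also have "\<dots> = (jacobian_matrix F x *v w) $ a"
    by (simp add: matrix_vector_mult_def jacobian_matrix_def partial case_prod_unfold mult.commute)
  finally show ?thesis ..
qed

lemma rank_jacobian_matrix_eq_full:
  fixes F :: "real ^ 'd ^ 'n \<Rightarrow> real ^ 'm"
  assumes diff: "\<And>a. (\<lambda>y. F y $ a) differentiable (at x)"
    and kernel: "\<And>v. (\<And>a D. ((\<lambda>y. F y $ a) has_derivative D) (at x) \<Longrightarrow> D v = 0) \<Longrightarrow> v = 0"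
  shows "rank (jacobian_matrix F x) = CARD('n) * CARD('d)"
proof -
  have "w = 0" if w: "jacobian_matrix F x *v w = 0" for w
  proof -
    have "(\<chi> i j. w $ (i, j)) = (0 :: real ^ 'd ^ 'n)"
      using w by (intro kernel) (simp flip: jacobian_matrix_mult_vector)
    then show ?thesis by (simp add: vec_eq_iff)
  qed
  then have "inj ((*v) (jacobian_matrix F x))"
    by (simp add: linear_injective_0[OF matrix_vector_mul_linear])
  then show ?thesis by (simp flip: full_rank_injective)
qed

section \<open>Derivatives along a fixed vector\<close>

lemma generated_algebra_derivative_zero:
  assumes "f \<in> generated_algebra S"
    and "\<And>g. g \<in> S \<Longrightarrow> \<exists>D. (g has_derivative D) (at x) \<and> D v = 0"
  shows "\<exists>D. (f has_derivative D) (at x) \<and> D v = 0"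
  using assms(1)
proof induction
  case (gen f)
  then show ?case by (rule assms(2))
next
  case (const c)
  show ?case by (intro exI[of _ "\<lambda>_. 0"]) simp
next
  case (add f g)
  then obtain D E where "(f has_derivative D) (at x)" "D v = 0"
    "(g has_derivative E) (at x)" "E v = 0" by blast
  then show ?case
    by (intro exI[of _ "\<lambda>h. D h + E h"]) (auto intro: has_derivative_add)
next
  case (mult f g)
  then obtain D E where "(f has_derivative D) (at x)" "D v = 0"
    "(g has_derivative E) (at x)" "E v = 0" by blast
  then show ?case
    by (intro exI[of _ "\<lambda>h. f x * E h + D h * g x"]) (auto intro: has_derivative_mult)
qed

lemma derivative_zero_cancel_factor:
  fixes f g :: "'a::real_normed_vector \<Rightarrow> real"
  assumes f: "(f has_derivative D) (at x)" and g: "(g has_derivative E) (at x)"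
    and "D v = 0" and "f x \<noteq> 0"
    and fg: "\<And>H. ((\<lambda>y. g y * f y) has_derivative H) (at x) \<Longrightarrow> H v = 0"
  shows "E v = 0"
  using fg[OF has_derivative_mult[OF g f]] assms(3,4) by simp

section \<open>Symmetric polynomials that separate distinct points\<close>

lemma symmetric_sum_components: "symmetric (\<lambda>y :: real ^ 'd ^ 'n. \<Sum>i\<in>UNIV. g (y $ i))"
proof -
  have "(\<Sum>i\<in>UNIV. g (y $ \<sigma> i)) = (\<Sum>i\<in>UNIV. g (y $ i))"
    if "\<sigma> permutes UNIV" for \<sigma> and y :: "real ^ 'd ^ 'n"
    using sum.permute[OF that, of "\<lambda>i. g (y $ i)"] by (simp add: comp_def)
  then show ?thesis by (simp add: symmetric_def)
qed

lemma real_polynomial_function_sum_components: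
  assumes "real_polynomial_function g"
  shows "real_polynomial_function (\<lambda>y :: real ^ 'd ^ 'n. \<Sum>i\<in>UNIV. g (y $ i))"
proof (intro real_polynomial_function_sum)
  fix i :: 'n
  have "polynomial_function (\<lambda>y :: real ^ 'd ^ 'n. y $ i)"
    by (intro polynomial_function_bounded_linear bounded_linear_vec_nth)
  from real_polynomial_function_compose[OF this assms]
  show "real_polynomial_function (\<lambda>y :: real ^ 'd ^ 'n. g (y $ i))"
    by (simp add: comp_def)
qed simp

lemma has_derivative_sum_components:
  fixes x :: "real ^ 'd ^ 'n"
  assumes "\<And>i. (g has_derivative D i) (at (x $ i))"
  shows "((\<lambda>y. \<Sum>i\<in>UNIV. g (y $ i)) has_derivative (\<lambda>h. \<Sum>i\<in>UNIV. D i (h $ i))) (at x)"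
proof (intro has_derivative_sum)
  fix i :: 'n
  have "((\<lambda>y. y $ i) has_derivative (\<lambda>h. h $ i)) (at x)"
    by (intro bounded_linear_imp_has_derivative bounded_linear_vec_nth)
  from has_derivative_compose[OF this assms]
  show "((\<lambda>y. g (y $ i)) has_derivative (\<lambda>h. D i (h $ i))) (at x)" .
qed

text \<open>
  The witness is \<open>g z = ((z - a) \<bullet> u) * (\<Prod>b\<in>S. |z - b|\<^sup>2)\<close>: it vanishes to second order on \<open>S\<close>,
  and at \<open>a\<close> only the linear factor vanishes.
\<close>

lemma separating_polynomial:
  fixes a u :: "'a::euclidean_space"
  assumes "finite S" "a \<notin> S" "u \<noteq> 0"
  obtains g D where "real_polynomial_function g"
    and "(g has_derivative D) (at a)" "D u \<noteq> 0"
    and "\<And>b. b \<in> S \<Longrightarrow> (g has_derivative (\<lambda>_. 0)) (at b)"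
proof -
  define q where "q T z = (\<Prod>b\<in>T. (z - b) \<bullet> (z - b))" for T and z :: 'a
  define g where "g z = ((z - a) \<bullet> u) * q S z" for z
  have poly_id: "polynomial_function (\<lambda>z::'a. z - b)" for b
    by (intro polynomial_function_diff polynomial_function_id polynomial_function_const)
  have poly_inner: "real_polynomial_function (\<lambda>z::'a. (z - b) \<bullet> u)" for b u
    using polynomial_function_inner[OF poly_id, of b u]
    by (simp add: real_polynomial_function_eq)
  have poly_dist: "real_polynomial_function (\<lambda>z::'a. (z - b) \<bullet> (z - b))" for b
    unfolding euclidean_inner[of "_ - b" "_ - b"]
    by (intro real_polynomial_function_sum real_polynomial_function.intros(4) poly_inner) simp
  have poly_q: "real_polynomial_function (q T)" if "finite T" for T
    unfolding q_def using that by (intro real_polynomial_function_prod poly_dist)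
  have poly_g: "real_polynomial_function g"
    unfolding g_def using assms(1) by (intro real_polynomial_function.intros(4) poly_inner poly_q)
  have diff: "\<exists>D. (f has_derivative D) (at z)" if "real_polynomial_function f" for f and z :: 'a
    using differentiable_at_real_polynomial_function[OF that, of z UNIV]
    by (simp add: differentiable_def)
  obtain Q where Q: "(q S has_derivative Q) (at a)"
    using diff poly_q assms(1) by blast
  have "((\<lambda>z. (z - a) \<bullet> u) has_derivative (\<lambda>h. h \<bullet> u)) (at a)"
    by (auto intro!: derivative_eq_intros)
  from has_derivative_mult[OF this Q]
  have "(g has_derivative (\<lambda>h. (h \<bullet> u) * q S a)) (at a)"
    by (simp add: g_def[abs_def])
  moreover have "(u \<bullet> u) * q S a \<noteq> 0"
    using assms by (auto simp: q_def)
  moreover have "(g has_derivative (\<lambda>_. 0)) (at b)" if "b \<in> S" for b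
  proof -
    \<comment> \<open>split off the factor at \<open>b\<close>, which vanishes there to second order\<close>
    define r where "r z = ((z - a) \<bullet> u) * q (S - {b}) z" for z
    have "real_polynomial_function r"
      unfolding r_def using assms(1) by (intro real_polynomial_function.intros(4) poly_inner poly_q) simp
    then obtain R where R: "(r has_derivative R) (at b)"
      using diff by blast
    have "((\<lambda>z. (z - b) \<bullet> (z - b)) has_derivative (\<lambda>_. 0)) (at b)"
      by (auto intro!: derivative_eq_intros)
    from has_derivative_mult[OF this R]
    have "((\<lambda>z. ((z - b) \<bullet> (z - b)) * r z) has_derivative (\<lambda>_. 0)) (at b)"
      by simp
    moreover have "g = (\<lambda>z. ((z - b) \<bullet> (z - b)) * r z)"
      by (simp add: g_def r_def q_def prod.remove[OF assms(1) that] fun_eq_iff)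
    ultimately show ?thesis by simp
  qed
  ultimately show ?thesis
    using that[OF poly_g] by blast
qed

lemma symmetric_polynomial_derivatives_separate:
  fixes x v :: "real ^ 'd ^ 'n"
  assumes "x \<notin> Sing"
    and zero: "\<And>f. real_polynomial_function f \<Longrightarrow> symmetric f \<Longrightarrow>
      \<exists>D. (f has_derivative D) (at x) \<and> D v = 0"
  shows "v = 0"
proof (rule ccontr)
  assume "v \<noteq> 0"
  then obtain i where i: "v $ i \<noteq> 0"
    by (metis vec_eq_iff zero_index)
  have "x $ i \<noteq> x $ j" if "j \<noteq> i" for j
    using assms(1) that by (simp add: Sing_def) metis
  then have notin: "x $ i \<notin> (($) x) ` (UNIV - {i})"
    by fastforce
  obtain g E where g: "real_polynomial_function g"
    and E: "(g has_derivative E) (at (x $ i))" "E (v $ i) \<noteq> 0"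
    and others: "\<And>b. b \<in> (($) x) ` (UNIV - {i}) \<Longrightarrow> (g has_derivative (\<lambda>_. 0)) (at b)"
    using separating_polynomial[OF finite_imageI[OF finite] notin i] by blast
  define D where "D j = (if j = i then E else (\<lambda>_. 0))" for j
  have "(g has_derivative D j) (at (x $ j))" for j
    using E others by (auto simp: D_def)
  from has_derivative_sum_components[OF this]
  have deriv: "((\<lambda>y. \<Sum>j\<in>UNIV. g (y $ j)) has_derivative (\<lambda>h. \<Sum>j\<in>UNIV. D j (h $ j))) (at x)" .
  obtain H where H: "((\<lambda>y. \<Sum>j\<in>UNIV. g (y $ j)) has_derivative H) (at x)" "H v = 0"
    using zero[OF real_polynomial_function_sum_components[OF g] symmetric_sum_components] by blast
  have "(\<Sum>j\<in>UNIV. D j (v $ j)) = 0"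
    using has_derivative_unique[OF deriv H(1)] H(2) by (simp add: fun_eq_iff)
  moreover have "(\<Sum>j\<in>UNIV. D j (v $ j)) = (\<Sum>j\<in>UNIV. if j = i then E (v $ i) else 0)"
    by (intro sum.cong) (auto simp: D_def)
  ultimately show False
    using E(2) by simp
qed

section \<open>Full rank away from the singular set\<close>

theorem proposition2p8:
  fixes \<phi> :: "real ^ 'd ^ 'n \<Rightarrow> real ^ 'p"
    and \<psi> :: "real ^ 'd ^ 'n \<Rightarrow> real ^ 'q"
  assumes card_p: "CARD('p) = (CARD('n) * (CARD('n) - 1) div 2) * (CARD('d) - 1) + 1"
    and phi_poly: "\<And>k. real_polynomial_function (\<lambda>x. \<phi> x $ k)"
    and phi_antisym: "\<And>k. antisymmetric (\<lambda>x. \<phi> x $ k)"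
    and phi_zero: "\<And>x. (\<forall>k. \<phi> x $ k = 0) \<longleftrightarrow> (\<exists>i j. i \<noteq> j \<and> x $ i = x $ j)"
    and psi_poly: "\<And>l. real_polynomial_function (\<lambda>x. \<psi> x $ l)"
    and psi_sym: "\<And>l. symmetric (\<lambda>x. \<psi> x $ l)"
    and psi_generate: "generated_algebra (range (\<lambda>l x. \<psi> x $ l)) =
      {f. real_polynomial_function f \<and> symmetric f}"
  shows "\<forall>x. x \<notin> Sing \<longrightarrow>
    rank (jacobian_matrix (eta \<phi> \<psi>) x) = CARD('n) * CARD('d)"
proof (intro allI impI)
  fix x :: "real ^ 'd ^ 'n"
  assume x: "x \<notin> Sing"
  have eta_None: "(\<lambda>y. eta \<phi> \<psi> y $ (None, k)) = (\<lambda>y. \<phi> y $ k)"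
    and eta_Some: "(\<lambda>y. eta \<phi> \<psi> y $ (Some l, k)) = (\<lambda>y. \<psi> y $ l * \<phi> y $ k)" for k l
    by (simp_all add: eta_def)
  have diff: "f differentiable (at x)" if "real_polynomial_function f" for f
    using that by (rule differentiable_at_real_polynomial_function)
  have "\<not> (\<forall>k. \<phi> x $ k = 0)"
    using x by (simp add: phi_zero Sing_def)
  then obtain k where k: "\<phi> x $ k \<noteq> 0"
    by blast
  show "rank (jacobian_matrix (eta \<phi> \<psi>) x) = CARD('n) * CARD('d)"
  proof (rule rank_jacobian_matrix_eq_full)
    fix a :: "'q option \<times> 'p"
    have "real_polynomial_function (\<lambda>y. eta \<phi> \<psi> y $ (b, k))" for b k
      by (cases b) (simp_all only: eta_None eta_Some phi_poly psi_poly real_polynomial_function.intros(4))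
    then show "(\<lambda>y. eta \<phi> \<psi> y $ a) differentiable (at x)"
      by (cases a) (simp add: diff)
  next
    fix v
    assume v: "\<And>a D. ((\<lambda>y. eta \<phi> \<psi> y $ a) has_derivative D) (at x) \<Longrightarrow> D v = 0"
    obtain D where D: "((\<lambda>y. \<phi> y $ k) has_derivative D) (at x)"
      using diff[OF phi_poly] unfolding differentiable_def by blast
    have Dv: "D v = 0"
      using v[of "(None, k)"] D by (simp add: eta_None)
    have "\<exists>E. ((\<lambda>y. \<psi> y $ l) has_derivative E) (at x) \<and> E v = 0" for l
    proof -
      obtain E where E: "((\<lambda>y. \<psi> y $ l) has_derivative E) (at x)"
        using diff[OF psi_poly] unfolding differentiable_def by blast
      have "E v = 0"
        using v[of "(Some l, k)"] unfolding eta_Some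
        by (rule derivative_zero_cancel_factor[OF D E Dv k])
      with E show ?thesis by blast
    qed
    then have "\<exists>E. (f has_derivative E) (at x) \<and> E v = 0"
      if "f \<in> generated_algebra (range (\<lambda>l x. \<psi> x $ l))" for f
      using generated_algebra_derivative_zero[OF that] by blast
    then show "v = 0"
      using psi_generate by (intro symmetric_polynomial_derivatives_separate[OF x]) blast
  qed
qed

end
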